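(* Let $n$ be a positive integer and let $m_1, m_2$ be integers with $\gcd(m_1,n)=\gcd(m_2,n)=1$. Then $12s(m_1/n)-12s(m_2/n)\in \mathbb{Z}$ if and only if $(m_1m_2-1)(m_1-m_2)\equiv 0 \pmod n$.
   Context: For a positive integer $n$ and an integer $m$ with $\gcd(m,n)=1$, the Dedekind sum is $s(m/n)=\sum_{k=1}^{n} ((k/n))((mk/n))$, where $((x))=x-\lfloor x\rfloor-1/2$ if $x\notin\mathbb{Z}$ and $((x))=0$ if $x\in\mathbb{Z}$ (the sawtooth function). *)

theory Defs
  imports Complex_Main "HOL-Number_Theory.Cong"
begin

definition sawtooth :: "real \<Rightarrow> real" where
  "sawtooth x = (if x \<in> \<int> then 0 else x - of_int \<lfloor>x\<rfloor> - 1 / 2)"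

(* dedekind_sum m n stands for s(m/n); the fraction is given by its numerator and
   denominator, and is only meant for n > 0 and coprime m n. *)
definition dedekind_sum :: "int \<Rightarrow> int \<Rightarrow> real" where
  "dedekind_sum m n =
    (\<Sum>k=1..n. sawtooth (of_int k / of_int n) * sawtooth (of_int (m * k) / of_int n))"

end

theory Submission
  imports Defs
begin

text \<open>
  Let \<open>r k = m k mod n\<close> and \<open>f k = m k div n\<close>. Expanding the sawtooth gives
  \<open>12 n s(m/n) = 12 (\<Sum> k (r k)) / n - 3 n (n - 1)\<close>. Since \<open>r\<close> permutes the residues, summing
  \<open>(r k)\<^sup>2 = (m k - n (f k))\<^sup>2\<close> yields
  \<open>2 m (\<Sum> k (r k)) = (m\<^sup>2 + 1) (\<Sum> k\<^sup>2) - n\<^sup>2 (\<Sum> (f k)\<^sup>2)\<close>, whence \<open>12 n s(m/n)\<close> is an integer \<open>a\<close>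
  with \<open>m a \<equiv> m\<^sup>2 + 1 (mod n)\<close>. The theorem follows by comparing these integers for \<open>m\<^sub>1\<close> and
  \<open>m\<^sub>2\<close> after multiplication by the unit \<open>m\<^sub>1 m\<^sub>2\<close>.
\<close>

lemma sum_int_lessThan:
  assumes "n \<ge> (0::int)"
  shows "2 * (\<Sum>k\<in>{0..<n}. k) = n * (n - 1)"
  using assms
proof (induction n rule: int_ge_induct)
  case (step i)
  then have "{0..<i + 1} = insert i {0..<i}" by auto
  with step show ?case by (simp add: algebra_simps)
qed simp

lemma sum_int_squares_lessThan:
  assumes "n \<ge> (0::int)"
  shows "6 * (\<Sum>k\<in>{0..<n}. k\<^sup>2) = n * (n - 1) * (2 * n - 1)"
  using assms
proof (induction n rule: int_ge_induct)
  case (step i)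
  then have "{0..<i + 1} = insert i {0..<i}" by auto
  with step show ?case by (simp add: algebra_simps power2_eq_square)
qed simp

text \<open>Multiplication by a unit permutes the residues. This lets a sum of any function of
  \<open>m * k mod n\<close> over \<open>{0..<n}\<close> be replaced by the same sum over
  \<open>k\<close>, below for first powers and for squares.\<close>

lemma bij_betw_mult_mod:
  fixes m n :: int
  assumes "n > 0" and "coprime m n"
  shows "bij_betw (\<lambda>k. m * k mod n) {0..<n} {0..<n}"
proof -
  have inj: "inj_on (\<lambda>k. m * k mod n) {0..<n}"
  proof (rule inj_onI)
    fix x y assume "x \<in> {0..<n}" "y \<in> {0..<n}" "m * x mod n = m * y mod n"
    then have "[x = y] (mod n)"
      using assms(2) by (simp add: cong_mult_lcancel flip: cong_def)
    with \<open>x \<in> _\<close> \<open>y \<in> _\<close> show "x = y" by (simp add: cong_def)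
  qed
  moreover have "(\<lambda>k. m * k mod n) ` {0..<n} = {0..<n}"
    using assms(1) by (intro endo_inj_surj inj) auto
  ultimately show ?thesis by (simp add: bij_betw_def)
qed

text \<open>The floor of \<open>j / n\<close> is \<open>j div n\<close>, so the fractional part is
  \<open>(j mod n) / n\<close>; non-divisibility keeps the argument out of the integer case.\<close>

lemma sawtooth_divide_of_int:
  fixes j n :: int
  assumes "n > 0" and "\<not> n dvd j"
  shows "sawtooth (of_int j / of_int n) = of_int (j mod n) / of_int n - 1 / 2"
proof -
  have "real_of_int j / of_int n \<notin> \<int>"
  proof
    assume "real_of_int j / of_int n \<in> \<int>"
    then obtain z where "real_of_int j / of_int n = of_int z" by (elim Ints_cases)
    with assms(1) have "real_of_int j = of_int (n * z)" by (simp add: field_simps)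
    then have "j = n * z" by (simp only: of_int_eq_iff)
    with assms(2) show False by simp
  qed
  then have "sawtooth (of_int j / of_int n) = of_int j / of_int n - of_int (j div n) - 1 / 2"
    by (simp add: sawtooth_def floor_divide_of_int_eq)
  moreover have "real_of_int j = of_int (n * (j div n)) + of_int (j mod n)"
    by (simp only: mult_div_mod_eq flip: of_int_add)
  then have "real_of_int j / of_int n = of_int (j div n) + of_int (j mod n) / of_int n"
    using assms(1) by (simp add: field_simps)
  ultimately show ?thesis by simp
qed

text \<open>The factor \<open>n ^ 2\<close> clears the denominators of both sawtooth values. The two
  linear sums agree by the permutation of residues, so only the mixed sum has no closed
  form.\<close>

lemma dedekind_sum_eq:
  fixes m n :: int
  assumes "n > 0" and "coprime m n"
  shows "12 * dedekind_sum m n * of_int n ^ 2 =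
    of_int (12 * (\<Sum>k\<in>{0..<n}. k * (m * k mod n)) - 3 * n\<^sup>2 * (n - 1))"
proof -
  have split: "{1..n} = insert n {1..<n}" "{0..<n} = insert 0 {1..<n}"
    using assms(1) by auto
  have "sawtooth (of_int n / of_int n) = 0"
    using assms(1) by (simp add: sawtooth_def)
  then have "dedekind_sum m n = (\<Sum>k\<in>{1..<n}.
      sawtooth (of_int k / of_int n) * sawtooth (of_int (m * k) / of_int n))"
    unfolding dedekind_sum_def split(1) by simp
  also have "\<dots> = (\<Sum>k\<in>{1..<n}. (of_int k / of_int n - 1 / 2) *
      (of_int (m * k mod n) / of_int n - 1 / 2))"
  proof (rule sum.cong)
    fix k assume k: "k \<in> {1..<n}"
    then have nk: "\<not> n dvd k" by (auto dest: zdvd_imp_le)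
    \<comment> \<open>Coprimality also keeps the second sawtooth factor out of its integer
      case.\<close>
    then have "\<not> n dvd m * k"
      using assms(2) by (simp add: coprime_dvd_mult_right_iff coprime_commute)
    then show "sawtooth (of_int k / of_int n) * sawtooth (of_int (m * k) / of_int n) =
        (of_int k / of_int n - 1 / 2) * (of_int (m * k mod n) / of_int n - 1 / 2)"
      using k by (simp add: sawtooth_divide_of_int[OF assms(1)] nk del: of_int_mult)
  qed simp
  finally have "12 * dedekind_sum m n * of_int n ^ 2 = (\<Sum>k\<in>{1..<n}.
      12 * ((of_int k / of_int n - 1 / 2) * (of_int (m * k mod n) / of_int n - 1 / 2)) *
      of_int n ^ 2)"
    by (simp only: sum_distrib_left sum_distrib_right)
  also have "\<dots> = (\<Sum>k\<in>{1..<n}. of_int (12 * (k * (m * k mod n)) - 6 * n * k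
      - 6 * n * (m * k mod n) + 3 * n\<^sup>2))"
    using assms(1) by (intro sum.cong) (simp_all add: field_simps power2_eq_square)
  also have "\<dots> = of_int (12 * (\<Sum>k\<in>{1..<n}. k * (m * k mod n)) - 6 * n * (\<Sum>k\<in>{1..<n}. k)
      - 6 * n * (\<Sum>k\<in>{1..<n}. m * k mod n) + 3 * n\<^sup>2 * (n - 1))"
    using assms(1) by (simp add: sum.distrib sum_subtractf flip: sum_distrib_left)
  \<comment> \<open>The terms at \<open>k = 0\<close> vanish, so each range extends to the full
    residue system on which the permutation acts.\<close>
  also have "(\<Sum>k\<in>{1..<n}. k * (m * k mod n)) = (\<Sum>k\<in>{0..<n}. k * (m * k mod n))"
    unfolding split(2) by simp
  also have "(\<Sum>k\<in>{1..<n}. k) = (\<Sum>k\<in>{0..<n}. k)"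
    unfolding split(2) by simp
  also have "(\<Sum>k\<in>{1..<n}. m * k mod n) = (\<Sum>k\<in>{0..<n}. m * k mod n)"
    unfolding split(2) by simp
  also have "(\<Sum>k\<in>{0..<n}. m * k mod n) = (\<Sum>k\<in>{0..<n}. k)"
    using sum.reindex_bij_betw[OF bij_betw_mult_mod[OF assms], of "\<lambda>k. k"] .
  also have "12 * (\<Sum>k\<in>{0..<n}. k * (m * k mod n)) - 6 * n * (\<Sum>k\<in>{0..<n}. k)
      - 6 * n * (\<Sum>k\<in>{0..<n}. k) + 3 * n\<^sup>2 * (n - 1) =
      12 * (\<Sum>k\<in>{0..<n}. k * (m * k mod n)) - 6 * n * (2 * (\<Sum>k\<in>{0..<n}. k))
      + 3 * n\<^sup>2 * (n - 1)" by simp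
  also have "\<dots> = 12 * (\<Sum>k\<in>{0..<n}. k * (m * k mod n)) - 3 * n\<^sup>2 * (n - 1)"
    using assms(1) by (subst sum_int_lessThan) (simp_all add: algebra_simps power2_eq_square)
  finally show ?thesis .
qed

lemma sum_mult_mod_eq:
  fixes m n :: int
  assumes "n > 0" and "coprime m n"
  shows "2 * m * (\<Sum>k\<in>{0..<n}. k * (m * k mod n)) =
    (m\<^sup>2 + 1) * (\<Sum>k\<in>{0..<n}. k\<^sup>2) - n\<^sup>2 * (\<Sum>k\<in>{0..<n}. (m * k div n)\<^sup>2)"
proof -
  have pointwise: "2 * m * (k * (m * k mod n)) =
      m\<^sup>2 * k\<^sup>2 + (m * k mod n)\<^sup>2 - n\<^sup>2 * (m * k div n)\<^sup>2" for k
  proof -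
    have "(n * (m * k div n))\<^sup>2 = (m * k - m * k mod n)\<^sup>2"
      by (simp add: minus_mod_eq_mult_div)
    then show ?thesis by (simp add: power2_diff power_mult_distrib)
  qed
  have "(\<Sum>k\<in>{0..<n}. (m * k mod n)\<^sup>2) = (\<Sum>k\<in>{0..<n}. k\<^sup>2)"
    using sum.reindex_bij_betw[OF bij_betw_mult_mod[OF assms], of "\<lambda>k. k\<^sup>2"] .
  moreover have "2 * m * (\<Sum>k\<in>{0..<n}. k * (m * k mod n)) =
      m\<^sup>2 * (\<Sum>k\<in>{0..<n}. k\<^sup>2) + (\<Sum>k\<in>{0..<n}. (m * k mod n)\<^sup>2)
      - n\<^sup>2 * (\<Sum>k\<in>{0..<n}. (m * k div n)\<^sup>2)"
    by (simp only: sum_distrib_left pointwise sum.distrib sum_subtractf)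
  ultimately show ?thesis by (simp add: distrib_right)
qed

text \<open>Since \<open>m\<close> is a unit modulo \<open>n\<close>, the congruence determines
  \<open>a\<close> modulo \<open>n\<close>, which is all that the integrality of a difference of two
  such sums depends on.\<close>

lemma dedekind_sum_cong:
  fixes m n :: int
  assumes "n > 0" and "coprime m n"
  obtains a :: int where "12 * dedekind_sum m n * of_int n = of_int a"
    and "[m * a = m\<^sup>2 + 1] (mod n)"
proof -
  define R where "R = (\<Sum>k\<in>{0..<n}. k * (m * k mod n))"
  define F where "F = (\<Sum>k\<in>{0..<n}. (m * k div n)\<^sup>2)"
  \<comment> \<open>The 12 splits as 2, needed for the mixed sum identity, times 6, needed for the
    closed form of the sum of squares, which brings out a factor \<open>n\<close>.\<close>
  have "m * (12 * R) = 6 * (2 * m * R)" by simp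
  also have "\<dots> = (m\<^sup>2 + 1) * (6 * (\<Sum>k\<in>{0..<n}. k\<^sup>2)) - 6 * n\<^sup>2 * F"
    unfolding R_def F_def sum_mult_mod_eq[OF assms] by (simp add: algebra_simps)
  also have "\<dots> = n * ((m\<^sup>2 + 1) * ((n - 1) * (2 * n - 1)) - 6 * n * F)"
    using assms(1) by (subst sum_int_squares_lessThan) (simp_all add: algebra_simps power2_eq_square)
  finally have mR: "m * (12 * R) = n * ((m\<^sup>2 + 1) * ((n - 1) * (2 * n - 1)) - 6 * n * F)" .
  then have "n dvd 12 * R"
    using assms(2) by (metis dvd_triv_left coprime_commute coprime_dvd_mult_right_iff)
  then obtain b where b: "12 * R = n * b" ..
  with mR assms(1) have mb: "m * b = (m\<^sup>2 + 1) * ((n - 1) * (2 * n - 1)) - 6 * n * F"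
    by (metis mult.left_commute mult_left_cancel less_irrefl)
  show thesis
  proof
    \<comment> \<open>Cancelling one factor \<open>n\<close> here yields the witness
      \<open>b - 3 * n * (n - 1)\<close> for \<open>a\<close>.\<close>
    have "12 * dedekind_sum m n * of_int n ^ 2 = of_int (n * b - 3 * n\<^sup>2 * (n - 1))"
      using dedekind_sum_eq[OF assms] by (simp only: b flip: R_def)
    also have "\<dots> = of_int (b - 3 * n * (n - 1)) * of_int n"
      by (simp add: algebra_simps power2_eq_square)
    finally show "12 * dedekind_sum m n * of_int n = of_int (b - 3 * n * (n - 1))"
      using assms(1) by (simp add: power2_eq_square)
    \<comment> \<open>Since \<open>(n - 1) * (2 * n - 1) = 1 + n * (2 * n - 3)\<close>, only
      \<open>m\<^sup>2 + 1\<close> survives modulo \<open>n\<close>.\<close>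
    have "m * (b - 3 * n * (n - 1)) - (m\<^sup>2 + 1) =
        n * ((m\<^sup>2 + 1) * (2 * n - 3) - 6 * F - 3 * m * (n - 1))"
      unfolding right_diff_distrib[of m b] mb by (simp add: algebra_simps)
    then show "[m * (b - 3 * n * (n - 1)) = m\<^sup>2 + 1] (mod n)"
      by (simp add: cong_iff_dvd_diff)
  qed
qed

theorem theorem2:
  fixes n m1 m2 :: int
  assumes "n > 0" and "gcd m1 n = 1" and "gcd m2 n = 1"
  shows "12 * dedekind_sum m1 n - 12 * dedekind_sum m2 n \<in> \<int> \<longleftrightarrow>
    [(m1 * m2 - 1) * (m1 - m2) = 0] (mod n)"
proof -
  have cop: "coprime m1 n" "coprime m2 n"
    using assms(2,3) by (simp_all add: coprime_iff_gcd_eq_1)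
  obtain a where a: "12 * dedekind_sum m1 n * of_int n = of_int a" "[m1 * a = m1\<^sup>2 + 1] (mod n)"
    using dedekind_sum_cong[OF assms(1) cop(1)] .
  obtain b where b: "12 * dedekind_sum m2 n * of_int n = of_int b" "[m2 * b = m2\<^sup>2 + 1] (mod n)"
    using dedekind_sum_cong[OF assms(1) cop(2)] .
  have "12 * dedekind_sum m1 n - 12 * dedekind_sum m2 n = of_int (a - b) / of_int n"
    using a(1) b(1) assms(1) by (simp add: field_simps)
  then have "12 * dedekind_sum m1 n - 12 * dedekind_sum m2 n \<in> \<int> \<longleftrightarrow> n dvd a - b"
    using assms(1) by (simp only: of_int_div_of_int_in_Ints_iff) simp
  also have "\<dots> \<longleftrightarrow> n dvd (m1 * m2) * (a - b)"
    using cop by (simp add: coprime_dvd_mult_right_iff coprime_commute)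
  \<comment> \<open>The unit is distributed so that \<open>a\<close> meets \<open>m1\<close> and
    \<open>b\<close> meets \<open>m2\<close>, the products whose residues are known.\<close>
  also have "\<dots> \<longleftrightarrow> [m2 * (m1 * a) - m1 * (m2 * b) = 0] (mod n)"
    by (simp add: cong_0_iff algebra_simps)
  also have "\<dots> \<longleftrightarrow> [m2 * (m1\<^sup>2 + 1) - m1 * (m2\<^sup>2 + 1) = 0] (mod n)"
    using cong_diff[OF cong_scalar_left[OF a(2), of m2] cong_scalar_left[OF b(2), of m1]]
    by (simp only: cong_def)
  also have "m2 * (m1\<^sup>2 + 1) - m1 * (m2\<^sup>2 + 1) = (m1 * m2 - 1) * (m1 - m2)"
    by (simp add: algebra_simps power2_eq_square)
  finally show ?thesis .
qed

end
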